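(* Let $q$ be a prime power, $\alpha$ a primitive element of $\mathbb{F}_{q^3}$, and $v$ a positive divisor of $q-1$ such that $q\ge v^4+6v^3+9v^2$. Then the array $\mathcal{A}_{q^3/q}(\alpha;v)$ is a covering array $\mathrm{CA}(v(q^2+q+1);\,3,\,q^2+q+1,\,v)$.
   Context: A primitive element of a finite field is a generator of its multiplicative group. Let $\mathrm{Tr}(x)=x+x^q+x^{q^2}$ be the trace from $\mathbb{F}_{q^3}$ to $\mathbb{F}_q$. The element $\omega=\alpha^{q^2+q+1}$ is a primitive element of $\mathbb{F}_q$; for $x\in\mathbb{F}_q^\times$, $\log_\omega(x)$ is the unique $j\in\{0,\dots,q-2\}$ with $\omega^j=x$. $\mathcal{A}_{q^3/q}(\alpha;v)$ is the $v(q^2+q+1)\times(q^2+q+1)$ array with entries in $\{0,\dots,v-1\}$ whose $(i,j)$ entry, for $0\le i\le v(q^2+q+1)-1$ and $0\le j\le q^2+q$, is $\log_\omega(\mathrm{Tr}(\alpha^{i+j}))\bmod v$ if $\mathrm{Tr}(\alpha^{i+j})\neq0$, and $0$ otherwise. A covering array $\mathrm{CA}(N;t,k,v)$ ($t\le k$) is an $N\times k$ array over an alphabet $V$ of size $v$ such that for every $t$ distinct columns, each element of $V^t$ occurs at least once as a row of the subarray formed by these columns. *)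

theory Defs
  imports
    "HOL-Library.Cardinality"
    "HOL-Number_Theory.Prime_Powers"
    "Jordan_Normal_Form.Matrix"
begin

definition primitive_element :: "'a::field \<Rightarrow> bool" where
  "primitive_element \<alpha> \<longleftrightarrow> range (\<lambda>n::int. \<alpha> powi n) = {x. x \<noteq> 0}"

definition cubic_trace :: "nat \<Rightarrow> 'a::field \<Rightarrow> 'a" where
  "cubic_trace q x = x + x ^ q + x ^ (q\<^sup>2)"

text \<open>Only meaningful when \<^term>\<open>\<omega>\<close> is a primitive element of the subfield of order
  \<^term>\<open>q\<close> and \<^term>\<open>x\<close> is a nonzero element of that subfield; otherwise the description
  may fail to denote.\<close>

definition discrete_log :: "nat \<Rightarrow> 'a::field \<Rightarrow> 'a \<Rightarrow> nat" where
  "discrete_log q \<omega> x = (THE j. j \<in> {0..q - 2} \<and> \<omega> ^ j = x)"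

text \<open>The type \<^typ>\<open>'a\<close> plays the role of the field with $q^3$ elements.\<close>

definition trace_array :: "nat \<Rightarrow> 'a::field \<Rightarrow> nat \<Rightarrow> nat mat" where
  "trace_array q \<alpha> v =
     mat (v * (q\<^sup>2 + q + 1)) (q\<^sup>2 + q + 1)
       (\<lambda>(i, j). if cubic_trace q (\<alpha> ^ (i + j)) \<noteq> 0
                 then discrete_log q (\<alpha> ^ (q\<^sup>2 + q + 1)) (cubic_trace q (\<alpha> ^ (i + j))) mod v
                 else 0)"

text \<open>The list \<^term>\<open>cs\<close> is a choice of \<^term>\<open>t\<close> distinct columns, and \<^term>\<open>w\<close> ranges
  over the \<^term>\<open>t\<close>-tuples over the alphabet \<^term>\<open>V\<close>.\<close>

definition covering_array ::
    "nat \<Rightarrow> nat \<Rightarrow> nat \<Rightarrow> nat \<Rightarrow> 'b set \<Rightarrow> 'b mat \<Rightarrow> bool" where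
  "covering_array N t k v V A \<longleftrightarrow>
     t \<le> k \<and> finite V \<and> card V = v \<and>
     A \<in> carrier_mat N k \<and> (\<forall>i<N. \<forall>j<k. A $$ (i, j) \<in> V) \<and>
     (\<forall>cs. length cs = t \<and> distinct cs \<and> set cs \<subseteq> {..<k} \<longrightarrow>
        (\<forall>w. length w = t \<and> set w \<subseteq> V \<longrightarrow>
           (\<exists>i<N. map (\<lambda>j. A $$ (i, j)) cs = w)))"

end

theory Submission
  imports Defs "HOL-Number_Theory.Residues" "HOL-Computational_Algebra.Polynomial"
begin

text \<open>Distinct columns correspond to powers of $\alpha$ that are pairwise independent over the
  subfield $F$ of order $q$. If three of them are independent, then the three traces of their
  multiples by $x$ take all values in $F^3$. Otherwise the third is a combination of the other two
  with nonzero coefficients $a$, $b$, the first two traces still take all values in $F^2$, and one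
  needs $a y + b z = u$ with $y$, $z$, $u$ in prescribed cosets of the group of $v$-th powers.
  No character sums are needed for this: a coset has $h = (q-1)/v$ elements, a variance count gives a
  solution as soon as $h^4 > q^3$, and this follows from the lower bound on $q$.\<close>

section \<open>Incidences between cosets: a second moment bound over a finite field\<close>

locale finite_subfield =
  fixes F :: "'a::field set"
  assumes finite: "finite F"
    and one: "1 \<in> F"
    and diff: "\<And>x y. x \<in> F \<Longrightarrow> y \<in> F \<Longrightarrow> x - y \<in> F"
    and mult: "\<And>x y. x \<in> F \<Longrightarrow> y \<in> F \<Longrightarrow> x * y \<in> F"
    and inverse: "\<And>x. x \<in> F \<Longrightarrow> inverse x \<in> F"
begin

lemma zero: "0 \<in> F"
  using diff[OF one one] by simp

lemma uminus: "x \<in> F \<Longrightarrow> - x \<in> F"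
  using diff[OF zero] by simp

lemma add: "x \<in> F \<Longrightarrow> y \<in> F \<Longrightarrow> x + y \<in> F"
  using diff[OF _ uminus, of x y] by simp

lemma divide: "x \<in> F \<Longrightarrow> y \<in> F \<Longrightarrow> x / y \<in> F"
  using mult[OF _ inverse] by (simp add: divide_inverse)

lemma card_pos: "card F > 0"
  using finite one by (auto simp: card_gt_0_iff)

lemma sum_translate:
  assumes "d \<in> F"
  shows "(\<Sum>x\<in>F. f (x + d)) = sum f F"
  by (rule sum.reindex_bij_witness[of _ "\<lambda>y. y - d" "\<lambda>x. x + d"])
    (use assms in \<open>auto intro: add diff\<close>)

text \<open>View \<open>(t, x)\<close> as the line with slope \<open>t\<close> and intercept
  \<open>x\<close>. Its heights above the distinct abscissas \<open>c\<close> and \<open>c'\<close>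
  determine it, and any two heights occur, so passing to heights is a bijection of
  \<open>F \<times> F\<close>.\<close>

lemma sum_two_points:
  assumes "c \<in> F" "c' \<in> F" "c \<noteq> c'"
  shows "(\<Sum>(t, x)\<in>F \<times> F. f (x + t * c) (x + t * c')) = (\<Sum>(y, z)\<in>F \<times> F. f y z)"
proof (rule sum.reindex_bij_witness[of _
      "\<lambda>(y, z). ((y - z) / (c - c'), y - (y - z) / (c - c') * c)"
      "\<lambda>(t, x). (x + t * c, x + t * c')"])
  fix p assume "p \<in> F \<times> F"
  then obtain y z where [simp]: "p = (y, z)" and yz: "y \<in> F" "z \<in> F" by auto
  have "y - d * c + d * c' = y - d * (c - c')" for d by (simp add: algebra_simps)
  from this[of "(y - z) / (c - c')"]
  have "y - (y - z) / (c - c') * c + (y - z) / (c - c') * c' = z" using assms by simp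
  then show "(case case p of (y, z) \<Rightarrow> ((y - z) / (c - c'), y - (y - z) / (c - c') * c) of
      (t, x) \<Rightarrow> (x + t * c, x + t * c')) = p" by simp
  show "(case p of (y, z) \<Rightarrow> ((y - z) / (c - c'), y - (y - z) / (c - c') * c)) \<in> F \<times> F"
    using yz assms by (auto intro!: diff divide mult)
next
  fix p assume "p \<in> F \<times> F"
  then obtain t x where [simp]: "p = (t, x)" and tx: "t \<in> F" "x \<in> F" by auto
  have "t * c - t * c' = t * (c - c')" by (simp add: algebra_simps)
  then show "(case case p of (t, x) \<Rightarrow> (x + t * c, x + t * c') of
      (y, z) \<Rightarrow> ((y - z) / (c - c'), y - (y - z) / (c - c') * c)) = p"
    using assms by simp
  show "(case p of (t, x) \<Rightarrow> (x + t * c, x + t * c')) \<in> F \<times> F"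
    using tx assms by (auto intro!: add mult)
qed auto

text \<open>A second moment argument: for $c \ne c'$ and uniformly random $(t, x)$, the points $x + tc$
  and $x + tc'$ are independent and uniform, so that the number of \<^term>\<open>c \<in> C\<close> with
  \<^term>\<open>x + t * c \<in> A\<close> has mean $|C||A|/|F|$ and total square deviation at most $|F||C||A|$.\<close>

lemma exists_incidence:
  assumes sub: "T \<subseteq> F" "X \<subseteq> F" "C \<subseteq> F" "A \<subseteq> F"
    and large: "card F ^ 3 < card T * card X * card C * card A"
  shows "\<exists>t\<in>T. \<exists>x\<in>X. \<exists>c\<in>C. x + t * c \<in> A"
proof (rule ccontr)
  assume none: "\<not> ?thesis"
  have fin: "finite T" "finite X" "finite C" "finite A"
    using sub finite by (auto intro: finite_subset)
  define q where "q = real (card F)"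
  have q: "q > 0" using card_pos by (simp add: q_def)
  define I :: "'a \<Rightarrow> real" where "I = (\<lambda>y. of_bool (y \<in> A))"
  have I_sq: "I y * I y = I y" for y by (simp add: I_def)
  have sum_I: "sum I F = card A"
    using sub finite by (simp add: I_def Int_absorb1 Int_absorb2)
  define N where "N = (\<lambda>(t, x). \<Sum>c\<in>C. I (x + t * c))"
  define m where "m = real (card C) * card A / q"
  have first: "sum N (F \<times> F) = card C * (q * card A)"
  proof -
    have "sum N (F \<times> F) = (\<Sum>c\<in>C. \<Sum>t\<in>F. \<Sum>x\<in>F. I (x + t * c))"
      unfolding N_def sum.cartesian_product[symmetric]
      by (subst sum.swap, subst sum.swap) (simp add: sum.swap[of _ C F])
    also have "\<dots> = (\<Sum>c\<in>C. \<Sum>t\<in>F. sum I F)"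
      using sub by (intro sum.cong refl sum_translate) (auto intro: mult)
    finally show ?thesis by (simp add: sum_I q_def)
  qed
  have second: "(\<Sum>p\<in>F \<times> F. (N p)\<^sup>2) \<le> card C * (q * card A) + (card C * card A)\<^sup>2"
  proof -
    \<comment> \<open>On the diagonal the term |A|^2 is a harmless surplus; including it there lets
      both cases sum to the full |C|^2 |A|^2.\<close>
    have pair: "(\<Sum>(t, x)\<in>F \<times> F. I (x + t * c) * I (x + t * c'))
        \<le> (if c = c' then q * card A else 0) + (real (card A))\<^sup>2"
      if c: "c \<in> C" "c' \<in> C" for c c'
    proof (cases "c = c'")
      case True
      have "(\<Sum>(t, x)\<in>F \<times> F. I (x + t * c) * I (x + t * c')) = (\<Sum>t\<in>F. \<Sum>x\<in>F. I (x + t * c))"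
        by (simp add: True I_sq sum.cartesian_product)
      also have "\<dots> = (\<Sum>t\<in>F. sum I F)"
        using sub c by (intro sum.cong refl sum_translate) (auto intro: mult)
      finally show ?thesis using True by (simp add: sum_I q_def)
    next
      case False
      have "(\<Sum>(t, x)\<in>F \<times> F. I (x + t * c) * I (x + t * c')) = (\<Sum>(y, z)\<in>F \<times> F. I y * I z)"
        using sub c False by (intro sum_two_points) auto
      also have "\<dots> = sum I F * sum I F"
        by (simp add: sum_product sum.cartesian_product)
      finally show ?thesis using False by (simp add: sum_I power2_eq_square)
    qed
    have "(\<Sum>p\<in>F \<times> F. (N p)\<^sup>2)
        = (\<Sum>p\<in>F \<times> F. \<Sum>c\<in>C. \<Sum>c'\<in>C. case p of (t, x) \<Rightarrow> I (x + t * c) * I (x + t * c'))"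
      by (intro sum.cong refl) (auto simp: N_def power2_eq_square sum_product)
    also have "\<dots> = (\<Sum>c\<in>C. \<Sum>c'\<in>C. \<Sum>p\<in>F \<times> F.
        case p of (t, x) \<Rightarrow> I (x + t * c) * I (x + t * c'))"
      by (subst sum.swap, intro sum.cong refl, subst sum.swap, rule refl)
    also have "\<dots> \<le> (\<Sum>c\<in>C. \<Sum>c'\<in>C. (if c = c' then q * card A else 0) + (real (card A))\<^sup>2)"
      by (intro sum_mono pair)
    also have "\<dots> = card C * (q * card A) + (card C * card A)\<^sup>2"
      using fin by (simp add: sum.distrib power2_eq_square algebra_simps)
    finally show ?thesis .
  qed
  have zero_N: "N p = 0" if "p \<in> T \<times> X" for p
    using that none by (auto simp: N_def I_def intro!: sum.neutral)
  \<comment> \<open>If no incidence exists, every point of \<open>T \<times> X\<close> deviates from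
    the mean by exactly \<open>m\<close>, which makes the variance large.\<close>
  have "card T * card X * m\<^sup>2 = (\<Sum>p\<in>T \<times> X. (N p - m)\<^sup>2)"
    by (simp add: zero_N card_cartesian_product)
  also have "\<dots> \<le> (\<Sum>p\<in>F \<times> F. (N p - m)\<^sup>2)"
    using sub finite by (intro sum_mono2) auto
  also have "\<dots> = (\<Sum>p\<in>F \<times> F. (N p)\<^sup>2) - 2 * m * sum N (F \<times> F) + q\<^sup>2 * m\<^sup>2"
    by (simp add: power2_diff sum.distrib sum_subtractf sum_distrib_left card_cartesian_product
        q_def power2_eq_square algebra_simps)
  \<comment> \<open>By \<open>first\<close>, the sum of \<open>N\<close> is q^2 m, so the last two
    terms combine to -(q m)^2 = -(|C| |A|)^2 and cancel the square in \<open>second\<close>.\<close>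
  also have "\<dots> \<le> card C * (q * card A)"
    using second q unfolding first m_def by (simp add: field_simps power2_eq_square)
  finally have "card T * card X * m\<^sup>2 * q\<^sup>2 \<le> card C * (q * card A) * q\<^sup>2"
    by (intro mult_right_mono) auto
  then have "(card T * card X * card C * card A) * (real (card C) * card A)
      \<le> q ^ 3 * (real (card C) * card A)"
    using q by (simp add: m_def field_simps power2_eq_square power3_eq_cube)
  moreover have "real (card C) * card A > 0"
    using large by (cases "card C = 0"; cases "card A = 0") auto
  ultimately have "real (card T * card X * card C * card A) \<le> real (card F ^ 3)"
    by (simp add: q_def mult_le_cancel_right)
  then show False using large by linarith
qed

end


section \<open>Primitive elements and Frobenius in a finite field\<close>

lemma primitive_element_nonzero:
  assumes "primitive_element \<alpha>"
  shows "\<alpha> \<noteq> 0"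
proof -
  have "\<alpha> powi 1 \<in> range (\<lambda>n::int. \<alpha> powi n)" by blast
  then show ?thesis using assms by (simp add: primitive_element_def)
qed

text \<open>Let \<open>d\<close> be the order of \<alpha>, which exists because powers must repeat
  in a finite type. The powers below \<open>d\<close> are distinct and exhaust the nonzero elements,
  so counting identifies \<open>d\<close>.\<close>

lemma primitive_element_bij_betw:
  fixes \<alpha> :: "'a::{field,finite}"
  assumes "primitive_element \<alpha>"
  shows "bij_betw (\<lambda>k. \<alpha> ^ k) {..<CARD('a) - 1} (UNIV - {0})"
    and "\<alpha> ^ (CARD('a) - 1) = 1"
proof -
  have nz: "\<alpha> \<noteq> 0" by (rule primitive_element_nonzero[OF assms])
  have cancel: "\<alpha> ^ (j - i) = 1" if "\<alpha> ^ i = \<alpha> ^ j" "i < j" for i j :: nat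
    using that nz by (simp add: power_diff)
  have "\<not> inj (\<lambda>n::nat. \<alpha> ^ n)"
    using finite_imageD[of "\<lambda>n::nat. \<alpha> ^ n" UNIV] by auto
  then obtain i j :: nat where "\<alpha> ^ i = \<alpha> ^ j" "i < j"
    unfolding inj_def by (metis nat_neq_iff)
  then have ex: "\<exists>d>0. \<alpha> ^ d = 1" using cancel by (meson zero_less_diff)
  define d where "d = (LEAST d. d > 0 \<and> \<alpha> ^ d = 1)"
  have d: "d > 0" "\<alpha> ^ d = 1"
    using LeastI_ex[OF ex] by (simp_all add: d_def)
  have minimal: "d \<le> n" if "n > 0" "\<alpha> ^ n = 1" for n
    unfolding d_def using that by (intro Least_le) auto
  have inj: "inj_on (\<lambda>k. \<alpha> ^ k) {..<d}"
  proof (rule linorder_inj_onI)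
    fix i j assume "i < j" "j \<in> {..<d}"
    then show "\<alpha> ^ i \<noteq> \<alpha> ^ j" using minimal[of "j - i"] cancel[of i j] by auto
  qed auto
  have "x \<in> (\<lambda>k. \<alpha> ^ k) ` {..<d}" if "x \<noteq> 0" for x
  proof -
    have "x \<in> range (\<lambda>n::int. \<alpha> powi n)"
      using assms that by (simp add: primitive_element_def)
    then obtain n :: int where "x = \<alpha> powi n" by blast
    \<comment> \<open>The definition supplies an integer exponent, possibly negative; its remainder
      modulo \<open>d\<close> is a natural number below \<open>d\<close>.\<close>
    also have "\<dots> = \<alpha> powi (int d * (n div int d) + n mod int d)" by simp
    also have "\<dots> = \<alpha> powi (n mod int d)"
      using nz d(2) by (subst power_int_add) (simp_all add: power_int_mult)
    also have "\<dots> = \<alpha> ^ nat (n mod int d)"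
      using d(1) by (simp add: power_int_def)
    finally show ?thesis using d(1) by (auto simp: nat_less_iff)
  qed
  then have image: "(\<lambda>k. \<alpha> ^ k) ` {..<d} = UNIV - {0}" using nz by auto
  then have "d = CARD('a) - 1"
    using card_image[OF inj] by (simp add: card_Diff_singleton)
  then show "bij_betw (\<lambda>k. \<alpha> ^ k) {..<CARD('a) - 1} (UNIV - {0})" "\<alpha> ^ (CARD('a) - 1) = 1"
    using inj image d(2) by (auto simp: bij_betw_def)
qed

lemma primitive_element_power_eq_1_iff:
  fixes \<alpha> :: "'a::{field,finite}"
  assumes "primitive_element \<alpha>"
  shows "\<alpha> ^ n = 1 \<longleftrightarrow> CARD('a) - 1 dvd n"
proof
  let ?d = "CARD('a) - 1"
  have "card {0, 1 :: 'a} \<le> CARD('a)" by (intro card_mono) auto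
  then have d: "?d > 0" by simp
  assume "\<alpha> ^ n = 1"
  moreover have "\<alpha> ^ n = (\<alpha> ^ ?d) ^ (n div ?d) * \<alpha> ^ (n mod ?d)"
    by (simp flip: power_mult power_add)
  ultimately have "\<alpha> ^ (n mod ?d) = \<alpha> ^ 0"
    using primitive_element_bij_betw(2)[OF assms] by simp
  then have "n mod ?d = 0"
    using primitive_element_bij_betw(1)[OF assms] d
    by (auto simp: bij_betw_def dest: inj_onD[of _ _ _ 0])
  then show "?d dvd n" by auto
next
  assume "CARD('a) - 1 dvd n"
  then obtain k where "n = (CARD('a) - 1) * k" by blast
  then show "\<alpha> ^ n = 1" by (simp only: power_mult primitive_element_bij_betw(2)[OF assms] power_one)
qed

text \<open>The order \<open>N\<close> is a parameter because this serves both \<alpha>, of order (q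
  - 1)(q^2 + q + 1), and its power \<omega>, of order q - 1.\<close>

lemma power_eq_power_iff_mod:
  fixes x :: "'a::field"
  assumes nz: "x \<noteq> 0" and ord: "\<And>n. x ^ n = 1 \<longleftrightarrow> N dvd n"
  shows "x ^ m = x ^ n \<longleftrightarrow> m mod N = n mod N"
proof (induction m n rule: linorder_wlog)
  case (le m n)
  have "x ^ n = x ^ m * x ^ (n - m)" using le by (simp flip: power_add)
  then have "x ^ m = x ^ n \<longleftrightarrow> x ^ (n - m) = 1" using nz by auto
  then show ?case using mod_eq_dvd_iff_nat[OF le, of N] ord by metis
next
  case (sym m n)
  then show ?case by metis
qed

text \<open>The characteristic divides the cardinality, a power of the prime below \<open>q\<close>,
  so it is that prime and \<open>q\<close> is a power of it.\<close>

lemma freshmans_dream_primepow: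
  fixes x y :: "'a::{field,finite}"
  assumes "primepow q" "CARD('a) = q ^ n"
  shows "(x + y) ^ q = x ^ q + y ^ q"
proof -
  have prime: "prime CHAR('a)"
    by (intro prime_CHAR_semidom finite_imp_CHAR_pos) simp
  obtain p k where p: "prime p" "q = p ^ k" using assms(1) by (auto simp: primepow_def)
  have "CHAR('a) dvd p ^ (k * n)"
    using CHAR_dvd_CARD[where 'a = 'a] by (simp add: assms(2) p power_mult)
  then have "CHAR('a) dvd p" using prime by (rule prime_dvd_power[rotated])
  then have "CHAR('a) = p" using prime p by (simp add: primes_dvd_imp_eq)
  then show ?thesis using prime p by (auto intro!: freshmans_dream')
qed

section \<open>The cubic extension and its subfield of order q\<close>

locale cubic_field_extension =
  fixes q :: nat and \<alpha> :: "'a::{field,finite}"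
  assumes primepow: "primepow q"
    and card_UNIV: "CARD('a) = q ^ 3"
    and primitive: "primitive_element \<alpha>"
begin

abbreviation Tr :: "'a \<Rightarrow> 'a" where "Tr \<equiv> cubic_trace q"

definition \<omega> :: 'a where "\<omega> = \<alpha> ^ (q\<^sup>2 + q + 1)"

text \<open>This is the subfield of order \<open>q\<close>, realised inside the big field as the
  fixed points of Frobenius; closure under subtraction then follows from additivity of
  Frobenius.\<close>

definition base :: "'a set" where "base = {x. x ^ q = x}"

lemma q_gt_1: "q > 1"
  using primepow primepow_gt_Suc_0 by auto

lemma cube_minus_1: "q ^ 3 - 1 = (q - 1) * (q\<^sup>2 + q + 1)"
proof -
  obtain m where "q = Suc m" using q_gt_1 by (cases q) auto
  then show ?thesis by (simp add: power2_eq_square power3_eq_cube algebra_simps)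
qed

lemma alpha_nonzero: "\<alpha> \<noteq> 0"
  by (rule primitive_element_nonzero[OF primitive])

lemma alpha_power_eq_1_iff: "\<alpha> ^ n = 1 \<longleftrightarrow> (q - 1) * (q\<^sup>2 + q + 1) dvd n"
  using primitive_element_power_eq_1_iff[OF primitive] by (simp only: card_UNIV cube_minus_1)

lemma nonzero_eq_alpha_power: "x \<noteq> 0 \<Longrightarrow> \<exists>n. x = \<alpha> ^ n"
  using primitive_element_bij_betw(1)[OF primitive] by (auto simp: bij_betw_def)

lemma omega_nonzero: "\<omega> \<noteq> 0"
  by (simp add: \<omega>_def alpha_nonzero)

lemma omega_power_eq_iff: "\<omega> ^ m = \<omega> ^ n \<longleftrightarrow> m mod (q - 1) = n mod (q - 1)"
proof (rule power_eq_power_iff_mod[OF omega_nonzero])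
  fix n
  have "\<omega> ^ n = \<alpha> ^ ((q\<^sup>2 + q + 1) * n)"
    unfolding \<omega>_def by (rule power_mult[symmetric])
  moreover have "(q - 1) * (q\<^sup>2 + q + 1) dvd (q\<^sup>2 + q + 1) * n \<longleftrightarrow> q - 1 dvd n"
    by (subst mult.commute) (rule dvd_times_left_cancel_iff, simp)
  ultimately show "\<omega> ^ n = 1 \<longleftrightarrow> q - 1 dvd n"
    by (simp only: alpha_power_eq_1_iff)
qed

lemma frobenius_add: "(x + y :: 'a) ^ q = x ^ q + y ^ q"
  by (rule freshmans_dream_primepow[OF primepow card_UNIV])

lemma power_cube: "x ^ (q ^ 3) = (x :: 'a)"
proof (cases "x = 0")
  case False
  then obtain n where n: "x = \<alpha> ^ n" using nonzero_eq_alpha_power by blast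
  have "q ^ 3 = Suc (q ^ 3 - 1)" using q_gt_1 by simp
  then have "x ^ (q ^ 3) = x * x ^ (q ^ 3 - 1)" by (metis power_Suc)
  also have "x ^ (q ^ 3 - 1) = \<alpha> ^ (n * (q ^ 3 - 1))" by (simp only: n power_mult)
  also have "\<dots> = 1" by (simp only: alpha_power_eq_1_iff cube_minus_1 dvd_triv_right)
  finally show ?thesis by simp
qed (use q_gt_1 in simp)

sublocale base: finite_subfield base
proof
  fix x y assume xy: "x \<in> base" "y \<in> base"
  have "x ^ q = (x - y) ^ q + y ^ q" using frobenius_add[of "x - y" y] by simp
  then show "x - y \<in> base" using xy by (simp add: base_def eq_diff_eq)
qed (auto simp: base_def power_mult_distrib power_inverse)

lemma omega_power_in_base: "\<omega> ^ n \<in> base"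
proof -
  have "n * q = n + n * (q - 1)" using q_gt_1 by (simp add: algebra_simps)
  then have "n * q mod (q - 1) = n mod (q - 1)" by simp
  then show ?thesis by (simp add: base_def omega_power_eq_iff flip: power_mult)
qed

text \<open>For x = \<alpha>^n, being fixed by Frobenius says that \<alpha>^(n (q - 1)) = 1.
  Cancelling q - 1 against the order of \<alpha> leaves q^2 + q + 1 dividing
  \<open>n\<close>.\<close>

lemma base_eq_omega_power:
  assumes "x \<in> base" "x \<noteq> 0"
  shows "\<exists>n. x = \<omega> ^ n"
proof -
  obtain n where n: "x = \<alpha> ^ n" using assms nonzero_eq_alpha_power by blast
  have "n * q = n + n * (q - 1)" using q_gt_1 by (simp add: algebra_simps)
  then have "x ^ q = x * \<alpha> ^ (n * (q - 1))" by (simp add: n flip: power_mult power_add)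
  then have "\<alpha> ^ (n * (q - 1)) = 1" using assms by (simp add: base_def)
  then have "(q - 1) * (q\<^sup>2 + q + 1) dvd (q - 1) * n"
    by (simp only: alpha_power_eq_1_iff mult.commute)
  then have "q\<^sup>2 + q + 1 dvd n" using q_gt_1 by (subst (asm) nat_mult_dvd_cancel1) auto
  then obtain k where "n = (q\<^sup>2 + q + 1) * k" by blast
  then show ?thesis unfolding n \<omega>_def by (auto simp only: power_mult)
qed

lemma card_base: "card base = q"
proof -
  have "base = insert 0 ((\<lambda>n. \<omega> ^ n) ` {..<q - 1})"
  proof (intro equalityI subsetI)
    fix x assume x: "x \<in> base"
    show "x \<in> insert 0 ((\<lambda>n. \<omega> ^ n) ` {..<q - 1})"
    proof (cases "x = 0")
      case False
      then obtain n where "x = \<omega> ^ n" using base_eq_omega_power x by blast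
      then have "x = \<omega> ^ (n mod (q - 1))" by (simp add: omega_power_eq_iff)
      then show ?thesis using q_gt_1 by auto
    qed simp
  qed (use omega_power_in_base base.zero in auto)
  moreover have "inj_on (\<lambda>n. \<omega> ^ n) {..<q - 1}"
    by (auto simp: inj_on_def omega_power_eq_iff)
  ultimately show ?thesis
    using q_gt_1 omega_nonzero by (simp add: card_insert_if card_image image_iff)
qed

section \<open>The trace form and its nondegeneracy\<close>

text \<open>Frobenius permutes the three summands cyclically, because x^(q^3) = x.\<close>

lemma Tr_in_base: "Tr x \<in> base"
proof -
  have "x ^ q ^ 2 = (x ^ q) ^ q" "(x ^ q ^ 2) ^ q = x ^ q ^ 3"
    by (simp_all add: power2_eq_square power3_eq_cube flip: power_mult)
  then show ?thesis
    by (simp add: base_def cubic_trace_def frobenius_add power_cube)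
qed

lemma Tr_add: "Tr (x + y) = Tr x + Tr y"
  by (simp add: cubic_trace_def frobenius_add power2_eq_square power_mult)

lemma Tr_mult: "c \<in> base \<Longrightarrow> Tr (c * x) = c * Tr x"
  by (simp add: cubic_trace_def base_def power2_eq_square power_mult power_mult_distrib
      algebra_simps)

lemma Tr_diff: "Tr (x - y) = Tr x - Tr y"
  using Tr_add[of "x - y" y] by simp

text \<open>The trace is given by a nonzero polynomial of degree at most q^2, which cannot vanish at
  all q^3 elements.\<close>

lemma Tr_nontrivial: "\<exists>x. Tr x \<noteq> 0"
proof (rule ccontr)
  assume "\<nexists>x. Tr x \<noteq> 0"
  then have zero: "Tr x = 0" for x by blast
  define p :: "'a poly" where "p = monom 1 1 + monom 1 q + monom 1 (q\<^sup>2)"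
  have q2: "q < q\<^sup>2" using q_gt_1 by (simp add: power2_eq_square)
  then have "poly.coeff p (q\<^sup>2) = 1" using q_gt_1 by (simp add: p_def)
  then have "p \<noteq> 0" by auto
  moreover have "poly p x = Tr x" for x
    by (simp add: p_def cubic_trace_def poly_monom)
  ultimately have "q ^ 3 \<le> degree p"
    using card_poly_roots_bound[of p] zero card_UNIV by simp
  also have "degree p \<le> q\<^sup>2"
    unfolding p_def using q2 q_gt_1
    by (intro degree_add_le order_trans[OF degree_monom_le]) auto
  also have "q\<^sup>2 < q ^ 3" using q_gt_1 by (intro power_strict_increasing) auto
  finally show False by simp
qed

text \<open>Three independent elements form a basis over \<open>base\<close>. If all three traces of
  z times a basis element vanish, then so does the trace of every multiple of z, forcing z = 0. The
  trace map is thus injective between sets of size q^3, hence onto.\<close>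

lemma traces_surjective:
  assumes indep: "\<And>a b c. a \<in> base \<Longrightarrow> b \<in> base \<Longrightarrow> c \<in> base \<Longrightarrow>
      a * \<beta>1 + b * \<beta>2 + c * \<beta>3 = 0 \<Longrightarrow> a = 0 \<and> b = 0 \<and> c = 0"
    and "y1 \<in> base" "y2 \<in> base" "y3 \<in> base"
  shows "\<exists>x. Tr (x * \<beta>1) = y1 \<and> Tr (x * \<beta>2) = y2 \<and> Tr (x * \<beta>3) = y3"
proof -
  let ?B = "base \<times> base \<times> base"
  have card_B: "card ?B = CARD('a)"
    by (simp add: card_cartesian_product card_base card_UNIV power3_eq_cube)
  define g where "g = (\<lambda>(a, b, c). a * \<beta>1 + b * \<beta>2 + c * \<beta>3)"
  have "inj_on g ?B"
  proof (rule inj_onI)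
    fix s t assume st: "s \<in> ?B" "t \<in> ?B" "g s = g t"
    obtain a b c a' b' c' where [simp]: "s = (a, b, c)" "t = (a', b', c')"
      by (metis prod_cases3)
    have "(a - a') * \<beta>1 + (b - b') * \<beta>2 + (c - c') * \<beta>3 = g s - g t"
      by (simp add: g_def algebra_simps)
    then have "a - a' = 0 \<and> b - b' = 0 \<and> c - c' = 0"
      using st by (intro indep base.diff) auto
    then show "s = t" by simp
  qed
  then have span: "g ` ?B = UNIV"
    using card_B by (intro card_subset_eq) (auto simp: card_image)
  define f where "f = (\<lambda>x. (Tr (x * \<beta>1), Tr (x * \<beta>2), Tr (x * \<beta>3)))"
  have "inj f"
  proof (rule injI)
    fix x y assume "f x = f y"
    define z where "z = x - y"
    have z: "Tr (z * \<beta>1) = 0" "Tr (z * \<beta>2) = 0" "Tr (z * \<beta>3) = 0"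
      using \<open>f x = f y\<close> by (simp_all add: f_def z_def left_diff_distrib Tr_diff)
    have vanish: "Tr (z * w) = 0" for w
    proof -
      have "w \<in> g ` ?B" by (simp add: span)
      then obtain a b c where abc: "a \<in> base" "b \<in> base" "c \<in> base"
          "w = a * \<beta>1 + b * \<beta>2 + c * \<beta>3"
        by (auto simp: g_def)
      have "z * w = a * (z * \<beta>1) + b * (z * \<beta>2) + c * (z * \<beta>3)"
        by (simp add: abc algebra_simps)
      then show ?thesis using abc z by (simp add: Tr_add Tr_mult)
    qed
    obtain u where "Tr u \<noteq> 0" using Tr_nontrivial by blast
    \<comment> \<open>A nonzero \<open>z\<close> has every element as a multiple, including
      \<open>u\<close>, whose trace is nonzero.\<close>
    then have "z = 0" using vanish[of "u / z"] by (cases "z = 0") auto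
    then show "x = y" by (simp add: z_def)
  qed
  moreover have "range f \<subseteq> ?B" by (auto simp: f_def Tr_in_base)
  ultimately have "range f = ?B"
    using card_B base.finite by (intro card_subset_eq) (auto simp: card_image)
  moreover have "(y1, y2, y3) \<in> ?B" using assms by simp
  ultimately have "(y1, y2, y3) \<in> range f" by simp
  then show ?thesis by (auto simp: f_def)
qed

lemma independent_extend:
  assumes indep: "\<And>a b. a \<in> base \<Longrightarrow> b \<in> base \<Longrightarrow> a * \<beta>1 + b * \<beta>2 = 0 \<Longrightarrow> a = 0 \<and> b = 0"
    and new: "\<And>a b. a \<in> base \<Longrightarrow> b \<in> base \<Longrightarrow> \<beta>3 \<noteq> a * \<beta>1 + b * \<beta>2"
    and abc: "a \<in> base" "b \<in> base" "c \<in> base" "a * \<beta>1 + b * \<beta>2 + c * \<beta>3 = 0"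
  shows "a = 0 \<and> b = 0 \<and> c = 0"
proof -
  have "c = 0"
  proof (rule ccontr)
    assume "c \<noteq> 0"
    then have "\<beta>3 = (- a / c) * \<beta>1 + (- b / c) * \<beta>2"
      using abc(4) by (simp add: field_simps) (simp add: eq_neg_iff_add_eq_0 algebra_simps)
    then show False using new[of "- a / c" "- b / c"] abc by (simp add: base.divide base.uminus)
  qed
  then show ?thesis using indep abc by simp
qed

text \<open>The span of the two elements has at most q^2 members, so some element outside it
  completes them to a basis.\<close>

lemma two_traces_surjective:
  assumes indep: "\<And>a b. a \<in> base \<Longrightarrow> b \<in> base \<Longrightarrow> a * \<beta>1 + b * \<beta>2 = 0 \<Longrightarrow> a = 0 \<and> b = 0"
    and y: "y1 \<in> base" "y2 \<in> base"
  shows "\<exists>x. Tr (x * \<beta>1) = y1 \<and> Tr (x * \<beta>2) = y2"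
proof -
  let ?S = "(\<lambda>(a, b). a * \<beta>1 + b * \<beta>2) ` (base \<times> base)"
  have "card ?S \<le> card (base \<times> base)"
    using base.finite by (intro card_image_le) auto
  also have "\<dots> < q ^ 3"
    using q_gt_1 by (simp add: card_cartesian_product card_base power3_eq_cube)
  finally have "?S \<noteq> UNIV" using card_UNIV by auto
  then obtain \<beta>3 where "\<beta>3 \<notin> ?S" by blast
  then have "\<beta>3 \<noteq> a * \<beta>1 + b * \<beta>2" if "a \<in> base" "b \<in> base" for a b
    using that by (auto simp: image_iff)
  note ext = independent_extend[OF indep this]
  \<comment> \<open>The value 0 for the auxiliary third trace is an arbitrary choice.\<close>
  have "\<exists>x. Tr (x * \<beta>1) = y1 \<and> Tr (x * \<beta>2) = y2 \<and> Tr (x * \<beta>3) = 0"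
    using y base.zero by (intro traces_surjective ext) auto
  then show ?thesis by blast
qed

section \<open>Columns, cosets of v-th powers and prescribed traces\<close>

text \<open>A dependence would make the ratio of the two powers a nonzero element of
  \<open>base\<close>, hence a power of \<omega>, and the exponents would agree modulo q^2 + q +
  1.\<close>

lemma columns_independent:
  assumes "i < q\<^sup>2 + q + 1" "j < q\<^sup>2 + q + 1" "i \<noteq> j"
    and "a \<in> base" "b \<in> base" "a * \<alpha> ^ i + b * \<alpha> ^ j = 0"
  shows "a = 0 \<and> b = 0"
proof (rule ccontr)
  assume "\<not> (a = 0 \<and> b = 0)"
  then have "a \<noteq> 0" "b \<noteq> 0" using assms alpha_nonzero by auto
  define c where "c = - a / b"
  have "c \<in> base" "c \<noteq> 0"
    using assms \<open>a \<noteq> 0\<close> \<open>b \<noteq> 0\<close> by (auto simp: c_def base.divide base.uminus)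
  then obtain n where n: "c = \<omega> ^ n" using base_eq_omega_power by blast
  have "\<alpha> ^ j = c * \<alpha> ^ i"
    using assms(6) \<open>b \<noteq> 0\<close> by (simp add: c_def field_simps eq_neg_iff_add_eq_0)
  also have "\<dots> = \<alpha> ^ ((q\<^sup>2 + q + 1) * n + i)"
    by (simp only: n \<omega>_def power_mult power_add)
  finally have "j mod ((q - 1) * (q\<^sup>2 + q + 1)) mod (q\<^sup>2 + q + 1)
      = ((q\<^sup>2 + q + 1) * n + i) mod ((q - 1) * (q\<^sup>2 + q + 1)) mod (q\<^sup>2 + q + 1)"
    by (simp only: power_eq_power_iff_mod[OF alpha_nonzero alpha_power_eq_1_iff])
  then have "j mod (q\<^sup>2 + q + 1) = ((q\<^sup>2 + q + 1) * n + i) mod (q\<^sup>2 + q + 1)"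
    by (simp only: mod_mod_cancel[OF dvd_triv_right])
  then show False using assms(1-3) by (simp only: mod_mult_self4 mod_less)
qed

text \<open>For \<open>v\<close> dividing q - 1, this is \<open>c\<close> times the coset of the
  nonzero v-th powers of \<open>base\<close> represented by \<omega>^w. The bound on
  \<open>m\<close> makes the listing free of repetitions when \<open>v\<close> is positive and
  \<open>c\<close> nonzero.\<close>

definition scaled_coset :: "nat \<Rightarrow> 'a \<Rightarrow> nat \<Rightarrow> 'a set" where
  "scaled_coset v c w = (\<lambda>m. c * \<omega> ^ (w + v * m)) ` {..<(q - 1) div v}"

lemma card_scaled_coset:
  assumes "v > 0" "v dvd q - 1" "c \<noteq> 0"
  shows "card (scaled_coset v c w) = (q - 1) div v"
proof -
  have "m = m'" if "m < (q - 1) div v" "m' < (q - 1) div v"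
    "c * \<omega> ^ (w + v * m) = c * \<omega> ^ (w + v * m')" for m m'
  proof -
    have "v * m < q - 1" "v * m' < q - 1"
      using that(1,2) assms by (auto elim!: dvdE)
    moreover have "\<omega> ^ (v * m) = \<omega> ^ (v * m')"
      using that(3) assms(3) omega_nonzero by (simp add: power_add)
    ultimately show ?thesis using assms(1) by (simp add: omega_power_eq_iff)
  qed
  then show ?thesis
    unfolding scaled_coset_def by (subst card_image) (auto simp: inj_on_def)
qed

lemma scaled_coset_subset: "c \<in> base \<Longrightarrow> scaled_coset v c w \<subseteq> base"
  by (auto simp: scaled_coset_def intro!: base.mult omega_power_in_base)

text \<open>Multiplying by a v-th power keeps an element in its coset, so the group of v-th powers
  can serve as the set of abscissas \<open>C\<close>. The equation thus becomes an incidence among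
  four sets of size (q - 1)/v, which explains the fourth power in \<open>large\<close>.\<close>

lemma exists_sum_in_coset:
  assumes v: "v > 0" "v dvd q - 1" and large: "q ^ 3 < ((q - 1) div v) ^ 4"
    and ab: "a \<in> base" "b \<in> base" "a \<noteq> 0" "b \<noteq> 0"
  shows "\<exists>e1 e2 e3. a * \<omega> ^ e1 + b * \<omega> ^ e2 = \<omega> ^ e3 \<and>
    e1 mod v = w1 mod v \<and> e2 mod v = w2 mod v \<and> e3 mod v = w3 mod v"
proof -
  have "\<exists>t\<in>scaled_coset v a w1. \<exists>x\<in>scaled_coset v b w2. \<exists>c\<in>scaled_coset v 1 0.
      x + t * c \<in> scaled_coset v 1 w3"
    using large ab base.one v
    by (intro base.exists_incidence scaled_coset_subset)
      (simp_all add: card_scaled_coset card_base power4_eq_xxxx)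
  then obtain k l m n where
    "b * \<omega> ^ (w2 + v * l) + a * \<omega> ^ (w1 + v * k) * \<omega> ^ (v * m) = \<omega> ^ (w3 + v * n)"
    by (auto simp: scaled_coset_def)
  moreover have "a * \<omega> ^ (w1 + v * k) * \<omega> ^ (v * m) = a * \<omega> ^ (w1 + v * (k + m))"
    by (simp add: power_add algebra_simps)
  ultimately have "a * \<omega> ^ (w1 + v * (k + m)) + b * \<omega> ^ (w2 + v * l) = \<omega> ^ (w3 + v * n)"
    by (simp add: add.commute)
  then show ?thesis by (metis mod_mult_self2)
qed

text \<open>Exponents are prescribed only modulo \<open>v\<close>: for dependent columns two traces
  determine the third, and the freedom within cosets is what makes all three compatible.\<close>

lemma exists_prescribed_traces:
  assumes v: "v > 0" "v dvd q - 1" and large: "q ^ 3 < ((q - 1) div v) ^ 4"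
    and j: "j1 < q\<^sup>2 + q + 1" "j2 < q\<^sup>2 + q + 1" "j3 < q\<^sup>2 + q + 1"
    and neq: "j1 \<noteq> j2" "j1 \<noteq> j3" "j2 \<noteq> j3"
  shows "\<exists>x e1 e2 e3. Tr (x * \<alpha> ^ j1) = \<omega> ^ e1 \<and> Tr (x * \<alpha> ^ j2) = \<omega> ^ e2 \<and>
    Tr (x * \<alpha> ^ j3) = \<omega> ^ e3 \<and> e1 mod v = w1 mod v \<and> e2 mod v = w2 mod v \<and> e3 mod v = w3 mod v"
proof (cases "\<exists>a\<in>base. \<exists>b\<in>base. \<alpha> ^ j3 = a * \<alpha> ^ j1 + b * \<alpha> ^ j2")
  case False
  then have "\<exists>x. Tr (x * \<alpha> ^ j1) = \<omega> ^ w1 \<and> Tr (x * \<alpha> ^ j2) = \<omega> ^ w2 \<and> Tr (x * \<alpha> ^ j3) = \<omega> ^ w3"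
    by (intro traces_surjective omega_power_in_base
        independent_extend[OF columns_independent[OF j(1,2) neq(1)]]) auto
  then show ?thesis by blast
next
  case True
  then obtain a b where ab: "a \<in> base" "b \<in> base" and rel: "\<alpha> ^ j3 = a * \<alpha> ^ j1 + b * \<alpha> ^ j2"
    by blast
  \<comment> \<open>If \<open>a\<close> were 0, columns \<open>j2\<close> and \<open>j3\<close>
    would be dependent; the case of \<open>b\<close> is symmetric.\<close>
  have "a \<noteq> 0"
    using columns_independent[OF j(2,3) neq(3), of b "- 1"] rel ab
    by (auto simp: base.one base.uminus)
  moreover have "b \<noteq> 0"
    using columns_independent[OF j(1,3) neq(2), of a "- 1"] rel ab
    by (auto simp: base.one base.uminus)
  ultimately obtain e1 e2 e3 where e: "a * \<omega> ^ e1 + b * \<omega> ^ e2 = \<omega> ^ e3"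
    "e1 mod v = w1 mod v" "e2 mod v = w2 mod v" "e3 mod v = w3 mod v"
    using exists_sum_in_coset[OF v large ab] by metis
  \<comment> \<open>Only the first two traces are imposed; the relation between the columns and
    \<open>e(1)\<close> then yield the third.\<close>
  obtain x where x: "Tr (x * \<alpha> ^ j1) = \<omega> ^ e1" "Tr (x * \<alpha> ^ j2) = \<omega> ^ e2"
    using two_traces_surjective[of "\<alpha> ^ j1" "\<alpha> ^ j2", OF columns_independent[OF j(1,2) neq(1)]]
      omega_power_in_base by metis
  have "x * \<alpha> ^ j3 = a * (x * \<alpha> ^ j1) + b * (x * \<alpha> ^ j2)"
    by (simp add: rel algebra_simps)
  then have "Tr (x * \<alpha> ^ j3) = \<omega> ^ e3" using ab e(1) x by (simp add: Tr_add Tr_mult)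
  then show ?thesis using x e by blast
qed

section \<open>From trace values to entries of the array\<close>

lemma discrete_log_omega_power: "discrete_log q \<omega> (\<omega> ^ e) = e mod (q - 1)"
  unfolding discrete_log_def
proof (rule the_equality)
  show "e mod (q - 1) \<in> {0..q - 2} \<and> \<omega> ^ (e mod (q - 1)) = \<omega> ^ e"
    using q_gt_1 mod_less_divisor[of "q - 1" e]
    by (auto simp: omega_power_eq_iff simp del: mod_less_divisor)
next
  fix j assume "j \<in> {0..q - 2} \<and> \<omega> ^ j = \<omega> ^ e"
  then show "j = e mod (q - 1)" using q_gt_1 by (auto simp: omega_power_eq_iff)
qed

text \<open>Shifting a row by $v(q^2+q+1)$ multiplies all traces by \<^term>\<open>\<omega> ^ v\<close>, which does not
  change their logarithms modulo \<^term>\<open>v\<close>.\<close>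

lemma exists_row:
  assumes v: "v > 0" "v dvd q - 1" and x: "x \<noteq> 0"
  shows "\<exists>i<v * (q\<^sup>2 + q + 1). \<forall>j<q\<^sup>2 + q + 1. \<forall>e.
    Tr (x * \<alpha> ^ j) = \<omega> ^ e \<longrightarrow> trace_array q \<alpha> v $$ (i, j) = e mod v"
proof -
  define M where "M = v * (q\<^sup>2 + q + 1)"
  have M: "M > 0" using v by (simp add: M_def)
  obtain n where n: "x = \<alpha> ^ n" using nonzero_eq_alpha_power x by blast
  define i k where "i = n mod M" and "k = v * (n div M)"
  have "n = (q\<^sup>2 + q + 1) * k + i"
    using div_mult_mod_eq[of n M] by (simp only: i_def k_def M_def mult_ac)
  then have x_eq: "x = \<omega> ^ k * \<alpha> ^ i"
    by (simp only: n \<omega>_def power_mult power_add)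
  have entry: "trace_array q \<alpha> v $$ (i, j) = e mod v"
    if j: "j < q\<^sup>2 + q + 1" and e: "Tr (x * \<alpha> ^ j) = \<omega> ^ e" for j e
  proof -
    have "x * \<alpha> ^ j = \<omega> ^ k * \<alpha> ^ (i + j)" by (simp add: x_eq power_add)
    then have eq: "\<omega> ^ k * Tr (\<alpha> ^ (i + j)) = \<omega> ^ e"
      using e by (simp add: Tr_mult omega_power_in_base)
    then have nz: "Tr (\<alpha> ^ (i + j)) \<noteq> 0" using omega_nonzero by auto
    then obtain e' where e': "Tr (\<alpha> ^ (i + j)) = \<omega> ^ e'"
      using base_eq_omega_power Tr_in_base by blast
    have "(k + e') mod (q - 1) = e mod (q - 1)"
      using eq by (simp add: e' omega_power_eq_iff flip: power_add)
    \<comment> \<open>Logarithms are known modulo q - 1, which descends to the divisor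
      \<open>v\<close>; there \<open>k\<close>, a multiple of \<open>v\<close>, disappears.\<close>
    then have "(k + e') mod v = e mod v" using v(2) by (metis mod_mod_cancel)
    then have "e' mod v = e mod v" by (simp add: k_def)
    then have "discrete_log q (\<alpha> ^ (q\<^sup>2 + q + 1)) (Tr (\<alpha> ^ (i + j))) mod v = e mod v"
      using v(2) by (simp only: e' discrete_log_omega_power mod_mod_cancel flip: \<omega>_def)
    moreover have "i < M" using M by (simp add: i_def)
    ultimately show ?thesis using nz j by (simp add: trace_array_def M_def)
  qed
  moreover have "i < M" using M by (simp add: i_def)
  ultimately show ?thesis unfolding M_def by blast
qed

end

section \<open>The numerical bound and the covering property\<close>

text \<open>After multiplication by v^4 the claim is v^4 q^3 < (q - 1)^4. It follows from v^4 < q -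
  4 and q^3 (q - 4) \<le> (q - 1)^4.\<close>

lemma coset_size_bound:
  fixes q v :: nat
  assumes "v > 0" "v dvd q - 1" "q \<ge> v ^ 4 + 6 * v ^ 3 + 9 * v\<^sup>2"
  shows "q ^ 3 < ((q - 1) div v) ^ 4"
proof -
  have "v ^ 3 \<ge> 1" "v\<^sup>2 \<ge> 1" using assms(1) by (simp_all add: Suc_le_eq)
  \<comment> \<open>The two lower terms of the hypothesis contribute at least 6 + 9 = 15.\<close>
  then have q: "q > v ^ 4 + 4" using assms(3) by linarith
  \<comment> \<open>This is Bernoulli's inequality (1 - 1/q)^4 \<ge> 1 - 4/q multiplied by q^4,
    stated over the reals to avoid truncated subtraction.\<close>
  have bernoulli: "real q ^ 3 * (real q - 4) \<le> (real q - 1) ^ 4"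
  proof -
    have "(real q - 1) ^ 4 - real q ^ 3 * (real q - 4) = 6 * (real q)\<^sup>2 - 4 * real q + 1"
      by (simp add: power4_eq_xxxx power3_eq_cube power2_eq_square algebra_simps)
    moreover have "real q * 1 \<le> real q * real q" using q by (intro mult_left_mono) auto
    ultimately show ?thesis by (simp add: power2_eq_square)
  qed
  have "real (v ^ 4 * q ^ 3) < real q ^ 3 * (real q - 4)"
  proof -
    have "real (v ^ 4 + 4) < real q" using q by (simp only: of_nat_less_iff)
    then have "real q ^ 3 * real (v ^ 4) < real q ^ 3 * (real q - 4)"
      using q by (intro mult_strict_left_mono) auto
    then show ?thesis by (simp add: mult.commute)
  qed
  also have "\<dots> \<le> (real q - 1) ^ 4" by (rule bernoulli)
  also have "\<dots> = real ((q - 1) ^ 4)" using q by (simp add: of_nat_diff)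
  finally have "v ^ 4 * q ^ 3 < (q - 1) ^ 4" by (simp only: of_nat_less_iff)
  also have "(q - 1) ^ 4 = v ^ 4 * ((q - 1) div v) ^ 4"
    using assms(2) by (simp flip: power_mult_distrib)
  finally show ?thesis by simp
qed

theorem mainTheorem2:
  fixes q v :: nat and \<alpha> :: "'a::{field,finite}"
  assumes "primepow q"
    and "CARD('a) = q ^ 3"
    and "primitive_element \<alpha>"
    and "v > 0"
    and "v dvd q - 1"
    and "q \<ge> v ^ 4 + 6 * v ^ 3 + 9 * v\<^sup>2"
  shows "covering_array (v * (q\<^sup>2 + q + 1)) 3 (q\<^sup>2 + q + 1) v {0..<v} (trace_array q \<alpha> v)"
proof -
  interpret cubic_field_extension q \<alpha>
    using assms by unfold_locales
  note v = assms(4,5)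
  have large: "q ^ 3 < ((q - 1) div v) ^ 4" by (rule coset_size_bound[OF assms(4-6)])
  have "\<exists>i<v * (q\<^sup>2 + q + 1). map (\<lambda>j. trace_array q \<alpha> v $$ (i, j)) cs = w"
    if cs: "length cs = 3" "distinct cs" "set cs \<subseteq> {..<q\<^sup>2 + q + 1}"
      and w: "length w = 3" "set w \<subseteq> {0..<v}" for cs w
  proof -
    obtain j1 j2 j3 where cs_eq: "cs = [j1, j2, j3]"
      using cs(1) by (auto simp: numeral_3_eq_3 length_Suc_conv)
    obtain w1 w2 w3 where w_eq: "w = [w1, w2, w3]"
      using w(1) by (auto simp: numeral_3_eq_3 length_Suc_conv)
    have j: "j1 < q\<^sup>2 + q + 1" "j2 < q\<^sup>2 + q + 1" "j3 < q\<^sup>2 + q + 1"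
      "j1 \<noteq> j2" "j1 \<noteq> j3" "j2 \<noteq> j3"
      using cs(2,3) by (auto simp: cs_eq)
    obtain x e1 e2 e3 where x: "Tr (x * \<alpha> ^ j1) = \<omega> ^ e1" "Tr (x * \<alpha> ^ j2) = \<omega> ^ e2"
      "Tr (x * \<alpha> ^ j3) = \<omega> ^ e3"
      and e: "e1 mod v = w1 mod v" "e2 mod v = w2 mod v" "e3 mod v = w3 mod v"
      using exists_prescribed_traces[OF v large j] by metis
    \<comment> \<open>A row is found by writing \<open>x\<close> as a power of \<alpha>, so 0 must
      be excluded; its traces vanish, whereas powers of \<omega> do not.\<close>
    have "x \<noteq> 0"
    proof
      assume "x = 0"
      then have "Tr (x * \<alpha> ^ j1) = 0" using q_gt_1 by (simp add: cubic_trace_def power_0_left)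
      then show False using x(1) omega_nonzero by simp
    qed
    then obtain i where "i < v * (q\<^sup>2 + q + 1)"
      "\<And>j e. j < q\<^sup>2 + q + 1 \<Longrightarrow> Tr (x * \<alpha> ^ j) = \<omega> ^ e \<Longrightarrow> trace_array q \<alpha> v $$ (i, j) = e mod v"
      using exists_row[OF v] by blast
    \<comment> \<open>The symbols of \<open>w\<close> are below \<open>v\<close>, so reducing them
      modulo \<open>v\<close> leaves them unchanged.\<close>
    then show ?thesis
      using x e j w by (intro exI[of _ i]) (auto simp: cs_eq w_eq)
  qed
  moreover have "3 \<le> q\<^sup>2 + q + 1" using q_gt_1 by simp
  moreover have "trace_array q \<alpha> v $$ (i, j) < v"
    if "i < v * (q\<^sup>2 + q + 1)" "j < q\<^sup>2 + q + 1" for i j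
    using that v by (simp add: trace_array_def)
  ultimately show ?thesis
    unfolding covering_array_def by (auto simp: trace_array_def)
qed

end
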